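(* Let $n\in\mathbb{N}$ and let $G=K_{2,n}$ be the complete bipartite graph with partite sets of sizes $2$ and $n$. Then for every integer $t\ge\chi_\ell(G)$ (the domain of the list epsilon flexibility function $\epsilon_\ell(G,\cdot)$), $$\epsilon_{\ell}(G,t)=\begin{cases}1/2 & \text{if } n=1 \text{ and } t\ge 2,\\ 0 & \text{if } n\in\{2,3\}\text{ and } t=2,\\ 1/2 & \text{otherwise.}\end{cases}$$
   Context: All graphs are nonempty, finite and simple; $\mathbb{N}=\{1,2,3,\ldots\}$. A list assignment $L$ for a graph $G$ assigns to each vertex $v$ a set $L(v)$ of colors; it is a $k$-assignment if $|L(v)|=k$ for every $v\in V(G)$. A proper $L$-coloring of $G$ is a proper coloring $f$ of $G$ with $f(v)\in L(v)$ for every $v\in V(G)$. The list chromatic number $\chi_\ell(G)$ is the smallest $k$ such that $G$ has a proper $L$-coloring for every $k$-assignment $L$ for $G$. A request of $L$ is a function $r$ with nonempty domain $D\subseteq V(G)$ such that $r(v)\in L(v)$ for each $v\in D$. For $\epsilon\in[0,1]$, the triple $(G,L,r)$ is $\epsilon$-satisfiable if there is a proper $L$-coloring $f$ of $G$ with $f(v)=r(v)$ for at least $\epsilon|D|$ vertices $v\in D$. The graph $G$ is $(k,\epsilon)$-flexible if $(G,L,r)$ is $\epsilon$-satisfiable for every $k$-assignment $L$ for $G$ and every request $r$ of $L$. The list epsilon flexibility function of $G$ maps each integer $t\ge\chi_\ell(G)$ to $\epsilon_\ell(G,t)$, the largest $\epsilon\in[0,1]$ such that $G$ is $(t,\epsilon)$-flexible.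 *)

theory Defs
  imports Complex_Main "Graph_Theory.Kuratowski"
begin

text \<open>
  Undirected graphs are symmetric digraphs, as in the locale \<open>graph\<close>, and two vertices
  are adjacent iff they form a pair in \<^const>\<open>arcs_ends\<close>. Colors are natural numbers;
  this loses no generality, because a finite graph with finite lists involves only
  finitely many colors.
\<close>

text \<open>The finiteness condition matters for \<open>k = 0\<close>, since infinite sets have cardinality 0.\<close>

definition list_assignment :: "('a, 'b) pre_digraph \<Rightarrow> nat \<Rightarrow> ('a \<Rightarrow> nat set) \<Rightarrow> bool" where
  "list_assignment G k L \<longleftrightarrow> (\<forall>v\<in>verts G. finite (L v) \<and> card (L v) = k)"

definition proper_list_coloring ::
    "('a, 'b) pre_digraph \<Rightarrow> ('a \<Rightarrow> nat set) \<Rightarrow> ('a \<Rightarrow> nat) \<Rightarrow> bool" where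
  "proper_list_coloring G L f \<longleftrightarrow>
     (\<forall>v\<in>verts G. f v \<in> L v) \<and> (\<forall>(u, v)\<in>arcs_ends G. f u \<noteq> f v)"

definition list_chromatic_number :: "('a, 'b) pre_digraph \<Rightarrow> nat" where
  "list_chromatic_number G =
     (LEAST k. \<forall>L. list_assignment G k L \<longrightarrow> (\<exists>f. proper_list_coloring G L f))"

definition request :: "('a, 'b) pre_digraph \<Rightarrow> ('a \<Rightarrow> nat set) \<Rightarrow> ('a \<rightharpoonup> nat) \<Rightarrow> bool" where
  "request G L r \<longleftrightarrow>
     dom r \<noteq> {} \<and> dom r \<subseteq> verts G \<and> (\<forall>v\<in>dom r. the (r v) \<in> L v)"

definition satisfiable ::
    "real \<Rightarrow> ('a, 'b) pre_digraph \<Rightarrow> ('a \<Rightarrow> nat set) \<Rightarrow> ('a \<rightharpoonup> nat) \<Rightarrow> bool" where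
  "satisfiable \<epsilon> G L r \<longleftrightarrow>
     (\<exists>f. proper_list_coloring G L f \<and>
          real (card {v \<in> dom r. r v = Some (f v)}) \<ge> \<epsilon> * real (card (dom r)))"

definition flexible :: "('a, 'b) pre_digraph \<Rightarrow> nat \<Rightarrow> real \<Rightarrow> bool" where
  "flexible G k \<epsilon> \<longleftrightarrow>
     (\<forall>L r. list_assignment G k L \<longrightarrow> request G L r \<longrightarrow> satisfiable \<epsilon> G L r)"

text \<open>Only meaningful for \<open>t \<ge> list_chromatic_number G\<close>: for smaller \<open>t\<close> the greatest element
  need not exist.\<close>

definition list_flexibility :: "('a, 'b) pre_digraph \<Rightarrow> nat \<Rightarrow> real" where
  "list_flexibility G t = (GREATEST \<epsilon>. 0 \<le> \<epsilon> \<and> \<epsilon> \<le> 1 \<and> flexible G t \<epsilon>)"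

end

(*
  Let a, b be the two vertices on the small side. Once a and b are coloured, a vertex v on the
  other side can be coloured as soon as its list has a colour left, so for t >= 3 any choice of
  colours for a and b extends. If at least half of the requests are on {a, b}, grant those.
  Otherwise take a bijection phi from L a to L b that fixes the common colours, and average over
  the t choices (c, phi c) of colours for (a, b): the pairs {c, phi c} are disjoint, so a request
  on the large side is violated at most once, and a request on a or b is granted once.
  Asking for the same colour on two adjacent vertices shows that 1/2 is optimal.
*)
theory Submission
  imports Defs
begin

section \<open>Matching two lists, and general facts on list colorings\<close>

lemma bij_betw_fixing_common_elements:
  assumes "finite A" "finite B" "card A = card B"
  obtains h where "bij_betw h A B" "\<And>x. x \<in> A \<inter> B \<Longrightarrow> h x = x"
proof -
  \<comment> \<open>Removing the common part from both sets leaves equally many elements, so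
    \<open>g\<close> matches the leftovers and \<open>h\<close> is the identity on the common
    part.\<close>
  have "card (A - B) = card (B - A)"
    using assms by (metis card_Diff_subset_Int finite_Int inf_commute)
  then obtain g where g: "bij_betw g (A - B) (B - A)"
    using assms by (meson finite_Diff finite_same_card_bij)
  define h where "h = (\<lambda>x. if x \<in> B then x else g x)"
  have "bij_betw h (A - B) (B - A)"
    using g by (rule bij_betw_cong[THEN iffD1, rotated]) (auto simp: h_def)
  moreover have "bij_betw h (A \<inter> B) (A \<inter> B)"
    by (rule bij_betwI') (auto simp: h_def)
  ultimately have "bij_betw h ((A - B) \<union> (A \<inter> B)) ((B - A) \<union> (A \<inter> B))"
    by (rule bij_betw_combine) blast
  moreover have "(A - B) \<union> (A \<inter> B) = A" "(B - A) \<union> (A \<inter> B) = B"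
    by auto
  ultimately show thesis
    using that by (auto simp: h_def)
qed

text \<open>Some working \<open>k\<close> must be known, since otherwise \<open>LEAST\<close> says
  nothing about its value. Colorability then passes upwards because every larger list can be cut
  down to a sublist of the minimal size.\<close>

lemma colorable_if_ge_list_chromatic_number:
  assumes "\<And>L. list_assignment G k L \<Longrightarrow> \<exists>f. proper_list_coloring G L f"
    and "list_chromatic_number G \<le> t" and "list_assignment G t L"
  shows "\<exists>f. proper_list_coloring G L f"
proof -
  let ?c = "list_chromatic_number G"
  have c: "\<forall>L. list_assignment G ?c L \<longrightarrow> (\<exists>f. proper_list_coloring G L f)"
    unfolding list_chromatic_number_def by (rule LeastI[of _ k]) (use assms(1) in blast)
  have "\<exists>S. S \<subseteq> L v \<and> finite S \<and> card S = ?c" if "v \<in> verts G" for v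
    using assms(2,3) that unfolding list_assignment_def
    by (metis obtain_subset_with_card_n)
  then obtain L' where L': "\<And>v. v \<in> verts G \<Longrightarrow> L' v \<subseteq> L v \<and> finite (L' v) \<and> card (L' v) = ?c"
    by metis
  then obtain f where "proper_list_coloring G L' f"
    using c unfolding list_assignment_def by blast
  then have "proper_list_coloring G L f"
    using L' unfolding proper_list_coloring_def by blast
  then show ?thesis by blast
qed

lemma flexible_0:
  assumes "\<And>L. list_assignment G t L \<Longrightarrow> \<exists>f. proper_list_coloring G L f"
  shows "flexible G t 0"
  using assms unfolding flexible_def satisfiable_def by simp

lemma satisfiable_half_iff:
  "satisfiable (1 / 2) G L r \<longleftrightarrow>
     (\<exists>f. proper_list_coloring G L f \<and> card (dom r) \<le> 2 * card {v \<in> dom r. r v = Some (f v)})"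
  unfolding satisfiable_def by (intro ex_cong1 conj_cong) (auto simp: field_simps)

section \<open>Complete bipartite graphs with small side \<open>a\<close>, \<open>b\<close> and
  large side \<open>V\<close>\<close>

locale complete_bipartite_2 =
  fixes G :: "('a, 'b) pre_digraph" and a b :: 'a and V :: "'a set"
  assumes ab: "a \<noteq> b" "a \<notin> V" "b \<notin> V"
    and verts_eq: "verts G = insert a (insert b V)"
    and ends_eq: "arcs_ends G = {a, b} \<times> V \<union> V \<times> {a, b}"
    and finV: "finite V" and V_ne: "V \<noteq> {}"
begin

lemma proper_list_coloring_iff:
  "proper_list_coloring G L f \<longleftrightarrow>
     f a \<in> L a \<and> f b \<in> L b \<and> (\<forall>v\<in>V. f v \<in> L v \<and> f v \<noteq> f a \<and> f v \<noteq> f b)"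
  unfolding proper_list_coloring_def verts_eq ends_eq by fastforce

text \<open>Vertices of \<open>V\<close> are pairwise nonadjacent, so each chooses its color
  separately: the requested one if it avoids \<open>x\<close> and \<open>y\<close>, any remaining
  one otherwise. Hence the only requests lost on \<open>V\<close> are those for \<open>x\<close> or
  \<open>y\<close>.\<close>

lemma extend_coloring:
  assumes "x \<in> L a" "y \<in> L b" and "\<And>v. v \<in> V \<Longrightarrow> L v - {x, y} \<noteq> {}"
    and r: "request G L r"
  obtains f where "proper_list_coloring G L f" "f a = x" "f b = y"
    "\<And>v c. v \<in> V \<Longrightarrow> r v = Some c \<Longrightarrow> c \<noteq> x \<Longrightarrow> c \<noteq> y \<Longrightarrow> f v = c"
proof -
  have "\<exists>c. c \<in> L v - {x, y} \<and> (\<forall>d. r v = Some d \<longrightarrow> d \<noteq> x \<longrightarrow> d \<noteq> y \<longrightarrow> c = d)"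
    if "v \<in> V" for v
  proof (cases "\<exists>d. r v = Some d \<and> d \<noteq> x \<and> d \<noteq> y")
    case True
    then obtain d where d: "r v = Some d" "d \<noteq> x" "d \<noteq> y" by blast
    then have "d \<in> L v" using r unfolding request_def by force
    then show ?thesis using d by auto
  next
    case False
    then show ?thesis using assms(3)[OF that] by blast
  qed
  then obtain g where g: "\<And>v. v \<in> V \<Longrightarrow> g v \<in> L v - {x, y} \<and>
      (\<forall>d. r v = Some d \<longrightarrow> d \<noteq> x \<longrightarrow> d \<noteq> y \<longrightarrow> g v = d)"
    by metis
  have ne: "v \<noteq> a" "v \<noteq> b" if "v \<in> V" for v using ab that by auto
  show thesis
    by (rule that[of "g(a := x, b := y)"])
      (use g ne ab(1) assms(1,2) in \<open>auto simp: proper_list_coloring_iff\<close>)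
qed

lemma list_minus_two_nonempty:
  assumes "list_assignment G t L" "3 \<le> t" "v \<in> V"
  shows "L v - {x, y} \<noteq> {}"
proof
  assume "L v - {x, y} = {}"
  then have "card (L v) \<le> card {x, y}" by (intro card_mono) auto
  also have "\<dots> \<le> 2" by (simp add: card_insert_if)
  finally show False using assms unfolding list_assignment_def verts_eq by auto
qed

section \<open>Lists of size at least 3\<close>

lemma satisfiable_half_by_granting_small_side:
  assumes L: "list_assignment G t L" "3 \<le> t" and r: "request G L r"
    and few: "card (dom r \<inter> V) \<le> card (dom r \<inter> {a, b})"
  shows "satisfiable (1 / 2) G L r"
proof -
  have ne: "L v \<noteq> {}" if "v \<in> verts G" for v
    using L that unfolding list_assignment_def by fastforce
  have "\<exists>c. c \<in> L v \<and> (v \<in> dom r \<longrightarrow> r v = Some c)" if "v \<in> verts G" for v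
  proof (cases "v \<in> dom r")
    case True
    then show ?thesis using r unfolding request_def by force
  next
    case False
    then show ?thesis using ne[OF that] by blast
  qed
  then obtain x y where x: "x \<in> L a" "a \<in> dom r \<longrightarrow> r a = Some x"
    and y: "y \<in> L b" "b \<in> dom r \<longrightarrow> r b = Some y"
    unfolding verts_eq by (metis insertI1 insertI2)
  obtain f where f: "proper_list_coloring G L f" "f a = x" "f b = y"
    by (rule extend_coloring[OF x(1) y(1) list_minus_two_nonempty[OF L] r])
  have dom: "dom r \<subseteq> insert a (insert b V)"
    using r unfolding request_def verts_eq by blast
  then have fin: "finite (dom r)" using finV by (auto intro: finite_subset)
  have "dom r = (dom r \<inter> {a, b}) \<union> (dom r \<inter> V)" using dom by auto
  then have "card (dom r) \<le> card (dom r \<inter> {a, b}) + card (dom r \<inter> V)"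
    by (metis card_Un_le)
  also have "\<dots> \<le> 2 * card (dom r \<inter> {a, b})" using few by simp
  also have "card (dom r \<inter> {a, b}) \<le> card {v \<in> dom r. r v = Some (f v)}"
    by (rule card_mono) (use fin f x(2) y(2) in auto)
  finally show ?thesis using f(1) unfolding satisfiable_half_iff by auto
qed

lemma satisfiable_half_by_averaging:
  assumes L: "list_assignment G t L" "3 \<le> t" and r: "request G L r"
    and many: "card (dom r \<inter> {a, b}) \<le> card (dom r \<inter> V)"
  shows "satisfiable (1 / 2) G L r"
proof (rule ccontr)
  assume unsat: "\<not> satisfiable (1 / 2) G L r"
  have fin: "finite (L a)" "finite (L b)" and card: "card (L a) = t" "card (L b) = t"
    using L(1) unfolding list_assignment_def verts_eq by auto
  obtain h where h: "bij_betw h (L a) (L b)" "\<And>x. x \<in> L a \<inter> L b \<Longrightarrow> h x = x"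
    using bij_betw_fixing_common_elements[of "L a" "L b"] fin card by metis
  have inj: "inj_on h (L a)" and him: "h ` L a = L b"
    using h(1) by (auto simp: bij_betw_def)
  have "\<exists>f. proper_list_coloring G L f \<and> f a = c \<and> f b = h c \<and>
      (\<forall>v\<in>V. \<forall>d. r v = Some d \<longrightarrow> d \<noteq> c \<longrightarrow> d \<noteq> h c \<longrightarrow> f v = d)" if c: "c \<in> L a" for c
  proof -
    have hc: "h c \<in> L b" using him c by blast
    show ?thesis
      by (rule extend_coloring[OF c hc list_minus_two_nonempty[OF L] r]) blast+
  qed
  then obtain F where F: "\<And>c. c \<in> L a \<Longrightarrow> proper_list_coloring G L (F c) \<and>
      F c a = c \<and> F c b = h c \<and>
      (\<forall>v\<in>V. \<forall>d. r v = Some d \<longrightarrow> d \<noteq> c \<longrightarrow> d \<noteq> h c \<longrightarrow> F c v = d)"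
    by metis
  let ?D = "dom r" and ?U = "dom r \<inter> {a, b}" and ?W = "dom r \<inter> V"
  have dom: "?D \<subseteq> insert a (insert b V)" and req: "\<And>v c. r v = Some c \<Longrightarrow> c \<in> L v"
    using r unfolding request_def verts_eq by force+
  then have finD: "finite ?D" using finV by (auto intro: finite_subset)
  have D: "?D = ?U \<union> ?W" "?U \<inter> ?W = {}" using dom ab by auto
  \<comment> \<open>\<open>?N v\<close> counts the colorings \<open>F c\<close> that grant the
    request at \<open>v\<close>; summing it over \<open>v\<close> and exchanging the sums gives the
    total number of grants.\<close>
  let ?N = "\<lambda>v. card {c \<in> L a. r v = Some (F c v)}"
  have U: "1 \<le> ?N v" if v: "v \<in> ?U" for v
  proof -
    obtain d where d: "r v = Some d" "d \<in> L v" using v req by blast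
    have "\<exists>c\<in>L a. F c v = d"
    proof (cases "v = a")
      case True
      then show ?thesis using d F by blast
    next
      case False
      then have "v = b" using v by blast
      \<comment> \<open>At \<open>b\<close> the granting coloring exists because \<open>h\<close> is
        onto \<open>L b\<close>.\<close>
      then have "d \<in> h ` L a" using d(2) him by simp
      then obtain c where "c \<in> L a" "h c = d" by blast
      then show ?thesis using F \<open>v = b\<close> by blast
    qed
    then have "{c \<in> L a. r v = Some (F c v)} \<noteq> {}" using d by auto
    then show ?thesis using fin by (simp add: Suc_le_eq card_gt_0_iff)
  qed
  have W: "t - 1 \<le> ?N v" if v: "v \<in> ?W" for v
  proof -
    obtain d where d: "r v = Some d" using v by blast
    let ?S = "{c \<in> L a. d = c \<or> d = h c}"
    \<comment> \<open>In the mixed case \<open>d = c\<close> and \<open>d = h c'\<close>, the color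
      \<open>d\<close> lies in both lists, so \<open>h c = c = h c'\<close> and injectivity
      applies.\<close>
    have "c = c'" if "c \<in> ?S" "c' \<in> ?S" for c c'
      using that h(2) him inj by (smt (verit) IntI imageI inj_onD mem_Collect_eq)
    then have "card ?S \<le> 1" using fin by (simp add: card_le_Suc0_iff_eq)
    moreover have "t - card ?S \<le> card (L a - ?S)"
      using card fin diff_card_le_card_Diff[of ?S "L a"] by simp
    moreover have "card (L a - ?S) \<le> ?N v"
      by (rule card_mono) (use fin F d v in auto)
    ultimately show ?thesis by linarith
  qed
  have "card ?U + (t - 1) * card ?W = (\<Sum>v\<in>?U. 1) + (\<Sum>v\<in>?W. t - 1)" by simp
  also have "\<dots> \<le> sum ?N ?U + sum ?N ?W" by (intro add_mono sum_mono U W)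
  also have "\<dots> = sum ?N ?D"
    using sum.union_disjoint[of ?U ?W ?N] finD D(2) unfolding D(1)[symmetric] by simp
  also have "\<dots> = (\<Sum>c\<in>L a. card {v \<in> ?D. r v = Some (F c v)})"
    by (rule sum_multicount_gen[OF finD fin(1)]) simp
  finally have low: "card ?U + (t - 1) * card ?W \<le> (\<Sum>c\<in>L a. card {v \<in> ?D. r v = Some (F c v)})" .
  have "2 * card {v \<in> ?D. r v = Some (F c v)} < card ?D" if "c \<in> L a" for c
    using unsat F[OF that] unfolding satisfiable_half_iff by (meson not_le)
  \<comment> \<open>A nonempty index set keeps the inequality strict after summation.\<close>
  moreover have "L a \<noteq> {}" using card L(2) by auto
  ultimately have "(\<Sum>c\<in>L a. 2 * card {v \<in> ?D. r v = Some (F c v)}) < (\<Sum>c\<in>L a. card ?D)"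
    using fin by (intro sum_strict_mono) auto
  then have high: "2 * (\<Sum>c\<in>L a. card {v \<in> ?D. r v = Some (F c v)}) < t * card ?D"
    by (simp add: sum_distrib_left card)
  have cardD: "card ?D = card ?U + card ?W"
    using card_Un_disjoint[of ?U ?W] finD D(2) unfolding D(1)[symmetric] by simp
  have less: "2 * (card ?U + (t - 1) * card ?W) < t * (card ?U + card ?W)"
    using mult_le_mono2[OF low, of 2] high unfolding cardD by (rule le_less_trans)
  \<comment> \<open>This removes the truncated subtraction: \<open>less\<close> reduces to
    \<open>s * card ?W < s * card ?U\<close>, against \<open>many\<close>.\<close>
  obtain s where "t = s + 2" using L(2) by (intro that[of "t - 2"]) simp
  moreover have "s * card ?U \<le> s * card ?W" using many by simp
  ultimately show False using less by (simp add: algebra_simps)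
qed

lemma flexible_half_if_ge_3:
  assumes "3 \<le> t"
  shows "flexible G t (1 / 2)"
  unfolding flexible_def
  using satisfiable_half_by_granting_small_side satisfiable_half_by_averaging assms
  by (meson nat_le_linear)

lemma colorable_if_ge_3:
  assumes L: "list_assignment G t L" "3 \<le> t"
  shows "\<exists>f. proper_list_coloring G L f"
proof -
  obtain x where "x \<in> L a"
    using L unfolding list_assignment_def verts_eq by fastforce
  \<comment> \<open>Satisfying any request produces a proper coloring; a request must have nonempty
    domain, so a single vertex is used.\<close>
  then have "request G L [a \<mapsto> x]"
    unfolding request_def verts_eq by simp
  then show ?thesis
    using flexible_half_if_ge_3[OF L(2)] L(1) unfolding flexible_def satisfiable_def by blast
qed

section \<open>Lists of size 2 on the path \<open>a\<close>, \<open>v\<close>,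
  \<open>b\<close>\<close>

lemma flexible_half_if_singleton:
  assumes V: "V = {v}"
  shows "flexible G 2 (1 / 2)"
  unfolding flexible_def
proof (intro allI impI)
  fix L r assume L: "list_assignment G 2 L" and r: "request G L r"
  have other: "\<exists>c. c \<in> L u \<and> c \<noteq> x" if "u \<in> {a, b, v}" for u x
  proof (rule ccontr)
    assume "\<not> ?thesis"
    then have "card (L u) \<le> card {x}" by (intro card_mono) auto
    then show False using L that unfolding list_assignment_def verts_eq V by auto
  qed
  have nv: "v \<noteq> a" "v \<noteq> b" using ab V by auto
  have color: "\<exists>f. proper_list_coloring G L f \<and> f a = x \<and> f b = y \<and> f v = z"
    if "x \<in> L a" "y \<in> L b" "z \<in> L v" "z \<noteq> x" "z \<noteq> y" for x y z
    by (rule exI[of _ "(\<lambda>_. z)(a := x, b := y)"])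
      (use that nv ab in \<open>auto simp: proper_list_coloring_iff V\<close>)
  have dom: "dom r \<subseteq> {a, b, v}" "dom r \<noteq> {}" and req: "\<And>u c. r u = Some c \<Longrightarrow> c \<in> L u"
    using r unfolding request_def verts_eq V by force+
  then have fin: "finite (dom r)" by (auto intro: finite_subset)
  show "satisfiable (1 / 2) G L r"
  \<comment> \<open>One granted request suffices for at most two requests, whereas three requests
    need two grants.\<close>
  proof (cases "card (dom r) \<le> 2")
    case True
    obtain u c where u: "u \<in> {a, b, v}" "r u = Some c" "c \<in> L u"
      using dom req by blast
    \<comment> \<open>Color outwards along the path from \<open>u\<close>: each new vertex has one
      colored neighbor, and \<open>other\<close> avoids its color.\<close>
    have "\<exists>f. proper_list_coloring G L f \<and> f u = c"
      using u color other by (metis insertE insertI1 insertI2 singletonD)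
    then obtain f where f: "proper_list_coloring G L f" "f u = c" by blast
    have "card {u} \<le> card {u \<in> dom r. r u = Some (f u)}"
      by (rule card_mono) (use fin u f in auto)
    then show ?thesis using True f(1) unfolding satisfiable_half_iff by auto
  next
    case False
    have "card {a, b, v} = 3" using ab nv by auto
    then have eq: "dom r = {a, b, v}"
      using False dom by (intro card_seteq) auto
    then obtain x y z where rs: "r a = Some x" "r b = Some y" "r v = Some z" by blast
    have mem: "x \<in> L a" "y \<in> L b" "z \<in> L v" using rs req by auto
    have two: ?thesis if "proper_list_coloring G L f" "p \<noteq> q" "p \<in> dom r" "q \<in> dom r"
      "r p = Some (f p)" "r q = Some (f q)" for f p q
    proof -
      have "card {p, q} \<le> card {u \<in> dom r. r u = Some (f u)}"
        by (rule card_mono) (use fin that in auto)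
      then show ?thesis
        using that \<open>card {a, b, v} = 3\<close> eq unfolding satisfiable_half_iff
        by (intro exI[of _ f]) auto
    qed
    \<comment> \<open>A third color at the center lets both end requests be granted; otherwise the
      center keeps its request together with one end.\<close>
    show ?thesis
    proof (cases "\<exists>d. d \<in> L v \<and> d \<noteq> x \<and> d \<noteq> y")
      case True
      then obtain f where "proper_list_coloring G L f" "f a = x" "f b = y"
        using color mem by blast
      then show ?thesis using two[of f a b] ab rs eq by auto
    next
      case False
      \<comment> \<open>Now \<open>L v = {x, y}\<close> with \<open>x \<noteq> y\<close>, so \<open>z\<close> conflicts with just one of the other requests.\<close>
      have "x \<noteq> y" using False other by blast
      then consider "z \<noteq> x" | "z \<noteq> y" by blast
      then show ?thesis
      proof cases
        case 1
        obtain y' where "y' \<in> L b" "y' \<noteq> z" using other by blast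
        then obtain f where "proper_list_coloring G L f" "f a = x" "f v = z"
          using color mem 1 by metis
        then show ?thesis using two[of f a v] nv rs eq by auto
      next
        case 2
        obtain x' where "x' \<in> L a" "x' \<noteq> z" using other by blast
        then obtain f where "proper_list_coloring G L f" "f b = y" "f v = z"
          using color mem 2 by metis
        then show ?thesis using two[of f b v] nv rs eq by auto
      qed
    qed
  qed
qed

section \<open>Upper bounds, and lists without a proper coloring\<close>

lemma flexible_le_half:
  assumes "flexible G t e" "1 \<le> t"
  shows "e \<le> 1 / 2"
proof -
  obtain v where v: "v \<in> V" "v \<noteq> a" using V_ne ab by blast
  \<comment> \<open>The color \<open>0\<close> lies in the common list \<open>{..<t}\<close> because
    \<open>1 \<le> t\<close>; the edge between \<open>a\<close> and \<open>v\<close> allows it at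
    only one of them.\<close>
  let ?r = "[a \<mapsto> 0, v \<mapsto> 0] :: 'a \<Rightarrow> nat option"
  have "list_assignment G t (\<lambda>_. {..<t})" "request G (\<lambda>_. {..<t}) ?r"
    using assms(2) v unfolding list_assignment_def request_def verts_eq by auto
  then obtain f where f: "proper_list_coloring G (\<lambda>_. {..<t}) f"
    and e: "e * card (dom ?r) \<le> card {u \<in> dom ?r. ?r u = Some (f u)}"
    using assms(1) unfolding flexible_def satisfiable_def by meson
  have "f a \<noteq> f v" using f v unfolding proper_list_coloring_iff by metis
  then have "{u \<in> dom ?r. ?r u = Some (f u)} \<subseteq> (if f a = 0 then {a} else {v})"
    by auto
  then have "card {u \<in> dom ?r. ?r u = Some (f u)} \<le> card (if f a = 0 then {a} else {v})"
    by (intro card_mono) auto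
  also have "\<dots> = 1" by simp
  finally have "real (card {u \<in> dom ?r. ?r u = Some (f u)}) \<le> 1" by simp
  moreover have "card (dom ?r) = 2" using v by simp
  ultimately show ?thesis using e by simp
qed

text \<open>A single request can be impossible: if \<open>a\<close> takes \<open>0\<close>, then
  \<open>v\<close> and \<open>w\<close> are forced to \<open>2\<close> and \<open>3\<close>, which
  blocks both colors of \<open>b\<close>.\<close>

lemma flexible_2_le_0:
  assumes "flexible G 2 e" "2 \<le> card V"
  shows "e \<le> 0"
proof -
  obtain v w where vw: "v \<in> V" "w \<in> V" "v \<noteq> w"
    using assms(2) finV by (metis card_le_Suc0_iff_eq not_less_eq_eq numeral_2_eq_2)
  have ne: "v \<noteq> a" "v \<noteq> b" "w \<noteq> a" "w \<noteq> b" using ab vw by auto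
  \<comment> \<open>Only \<open>v\<close> and \<open>w\<close> matter; the remaining vertices of
    \<open>V\<close> share the list of \<open>w\<close>.\<close>
  define L :: "'a \<Rightarrow> nat set"
    where "L u = (if u = a then {0, 1} else if u = b then {2, 3} else if u = v then {0, 2} else {0, 3})"
    for u
  have Ls: "L a = {0, 1}" "L b = {2, 3}" "L v = {0, 2}" "L w = {0, 3}"
    using ne ab vw unfolding L_def by auto
  let ?r = "[a \<mapsto> 0] :: 'a \<Rightarrow> nat option"
  have "list_assignment G 2 L" "request G L ?r"
    unfolding list_assignment_def request_def verts_eq by (auto simp: L_def)
  then obtain f where f: "proper_list_coloring G L f"
    and e: "e * card (dom ?r) \<le> card {u \<in> dom ?r. ?r u = Some (f u)}"
    using assms(1) unfolding flexible_def satisfiable_def by meson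
  have "f b \<in> {2, 3}" "f v \<in> {0, 2}" "f w \<in> {0, 3}" "f v \<noteq> f a" "f v \<noteq> f b"
    "f w \<noteq> f a" "f w \<noteq> f b"
    using f vw unfolding proper_list_coloring_iff by (metis Ls)+
  then have "f a \<noteq> 0" by auto
  then have none: "{u \<in> dom ?r. ?r u = Some (f u)} = {}" by auto
  show ?thesis using e unfolding none by simp
qed

text \<open>Give \<open>a\<close> and \<open>b\<close> disjoint lists of size 2. Each of the four
  possible color pairs is the whole list of one vertex of \<open>V\<close>, so every choice on
  \<open>a\<close> and \<open>b\<close> leaves some vertex without a color.\<close>

lemma not_2_choosable_if_card_ge_4:
  assumes "4 \<le> card V"
  obtains L where "list_assignment G 2 L" "\<nexists>f. proper_list_coloring G L f"
proof -
  obtain g where g: "bij_betw g {0..<card V} V"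
    using ex_bij_betw_nat_finite[OF finV] by blast
  have gV: "g i \<in> V" if "i < 4" for i
    using g that assms by (auto simp: bij_betw_def)
  have inj: "g i = g j \<longleftrightarrow> i = j" if "i < 4" "j < 4" for i j
    using bij_betw_imp_inj_on[OF g] that assms by (simp add: inj_on_eq_iff)
  have ne: "g i \<noteq> a" "g i \<noteq> b" if "i < 4" for i using gV[OF that] ab by auto
  \<comment> \<open>The default \<open>{1, 3}\<close> serves \<open>g 3\<close> and pads any
    vertices beyond the four.\<close>
  define L :: "'a \<Rightarrow> nat set"
    where "L u = (if u = a then {0, 1} else if u = b then {2, 3} else if u = g 0 then {0, 2}
      else if u = g 1 then {0, 3} else if u = g 2 then {1, 2} else {1, 3})" for u
  have Ls: "L a = {0, 1}" "L b = {2, 3}" "L (g 0) = {0, 2}" "L (g 1) = {0, 3}"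
    "L (g 2) = {1, 2}" "L (g 3) = {1, 3}"
    using ne ab(1) by (auto simp: L_def inj)
  have "\<nexists>f. proper_list_coloring G L f"
  proof
    assume "\<exists>f. proper_list_coloring G L f"
    then obtain f where f: "f a \<in> L a" "f b \<in> L b"
      "\<And>v. v \<in> V \<Longrightarrow> f v \<in> L v \<and> f v \<noteq> f a \<and> f v \<noteq> f b"
      unfolding proper_list_coloring_iff by blast
    have "f a = 0 \<or> f a = 1" "f b = 2 \<or> f b = 3"
      using f(1,2) unfolding Ls by auto
    moreover have "f (g 0) \<in> L (g 0) - {f a, f b}" "f (g 1) \<in> L (g 1) - {f a, f b}"
      "f (g 2) \<in> L (g 2) - {f a, f b}" "f (g 3) \<in> L (g 3) - {f a, f b}"
      using f(3) gV by simp_all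
    ultimately show False
      unfolding Ls by (elim disjE) simp_all
  qed
  moreover have "list_assignment G 2 L"
    unfolding list_assignment_def by (auto simp: L_def)
  ultimately show thesis using that by blast
qed

text \<open>The lists \<open>{..<t}\<close> handle both sizes: they are empty for
  \<open>t = 0\<close>, and for \<open>t = 1\<close> they force \<open>0\<close> on both ends of an
  edge.\<close>

lemma not_choosable_if_le_1:
  assumes "t \<le> 1"
  obtains L where "list_assignment G t L" "\<nexists>f. proper_list_coloring G L f"
proof
  show "list_assignment G t (\<lambda>_. {..<t})" unfolding list_assignment_def by simp
  show "\<nexists>f. proper_list_coloring G (\<lambda>_. {..<t}) f"
    using V_ne assms unfolding proper_list_coloring_iff by fastforce
qed

end

section \<open>Transfer to the given digraph and the case distinction\<close>

lemma complete_bipartite_2_if_complete_bipartite_digraph: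
  assumes "K\<^bsub>2,n\<^esub> G" "1 \<le> n"
  obtains a b V where "complete_bipartite_2 G a b V" "card V = n"
proof -
  obtain U V where UV: "verts G = U \<union> V" "U \<inter> V = {}" "card U = 2" "card V = n"
    "arcs_ends G = U \<times> V \<union> V \<times> U"
    using assms(1) unfolding complete_bipartite_digraph_def by blast
  obtain a b where ab: "U = {a, b}" "a \<noteq> b" using UV(3) by (meson card_2_iff)
  \<comment> \<open>Infinite sets have cardinality 0, so a positive cardinality yields finiteness as
    well.\<close>
  have "finite V" "V \<noteq> {}" using UV(4) assms(2) by (auto intro: card_ge_0_finite)
  then have "complete_bipartite_2 G a b V"
    using UV(1,2,5) ab(2) unfolding ab(1) by unfold_locales simp_all
  then show thesis using that UV(4) by blast
qed

theorem theorem7: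
  fixes G :: "('a, 'b) pre_digraph" and n t :: nat
  assumes "n \<ge> 1"
    and "K\<^bsub>2,n\<^esub> G"
    and "t \<ge> list_chromatic_number G"
  shows "list_flexibility G t =
    (if n = 1 \<and> t \<ge> 2 then 1 / 2
     else if n \<in> {2, 3} \<and> t = 2 then 0
     else 1 / 2)"
proof -
  obtain a b V where "complete_bipartite_2 G a b V" and n: "card V = n"
    using complete_bipartite_2_if_complete_bipartite_digraph assms(1,2) by metis
  then interpret complete_bipartite_2 G a b V by blast
  \<comment> \<open>Colorability from lists of size 3 provides the witness behind
    \<open>LEAST\<close>.\<close>
  have col: "\<exists>f. proper_list_coloring G L f" if "list_assignment G t L" for L
    using colorable_if_ge_list_chromatic_number[OF colorable_if_ge_3[of 3] assms(3) that] by simp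
  have t: "2 \<le> t"
  proof (rule ccontr)
    assume "\<not> ?thesis"
    then have "t \<le> 1" by simp
    then show False using not_choosable_if_le_1 col by metis
  qed
  show ?thesis
  \<comment> \<open>The first and last branches of the formula agree, so two cases suffice.\<close>
  proof (cases "n \<in> {2, 3} \<and> t = 2")
    case True
    have "list_flexibility G t = 0"
      unfolding list_flexibility_def
      by (rule Greatest_equality) (use True n flexible_2_le_0 flexible_0[of G t, OF col] in auto)
    then show ?thesis using True by auto
  next
    case False
    have "flexible G t (1 / 2)"
    proof (cases "t = 2")
      case True
      \<comment> \<open>For \<open>t = 2\<close>, colorability excludes \<open>4 \<le> n\<close> and
        the case assumption excludes 2 and 3, leaving the path.\<close>
      then have "n < 4" using not_2_choosable_if_card_ge_4 col n by (metis not_le)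
      then have "card V = 1" using False True n assms(1) by auto
      then show ?thesis using flexible_half_if_singleton True by (metis card_1_singletonE)
    next
      case False
      then show ?thesis using t flexible_half_if_ge_3 by simp
    qed
    then have "list_flexibility G t = 1 / 2"
      unfolding list_flexibility_def
      by (intro Greatest_equality) (use t flexible_le_half in auto)
    then show ?thesis using False by auto
  qed
qed

end
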